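(* Let $T$ be a finite tree and let $v \in V(T)$. Then $$\sum_{w\in V(T)} \left( H_{vw} + d(v,w) \right) = 2W(T).$$ Equivalently, $CC(v) + D(v) = 2W(T)$.
   Context: For a finite connected graph, the simple random walk moves at each step from its current vertex to a uniformly random neighbour. The hitting time $H_{vw}$ is the expected number of steps for the simple random walk started at $v$ to first reach $w$ (so $H_{vv}=0$). $d(v,w)$ is the graph distance. The Wiener index is $W(T)=\sum_{\{x,y\}\subseteq V(T)} d(x,y)$ (sum over unordered pairs of distinct vertices). The cover cost is $CC(v)=\sum_{w\in V(T)} H_{vw}$ and the centrality is $D(v)=\sum_{w\in V(T)} d(v,w)$. *)

theory Defs
  imports "HOL-Probability.Probability" "Graph_Theory.Graph_Theory"
begin

text \<open>
  Finite simple graphs are the finite, loop-free, symmetric digraphs without parallel arcs of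
  the locale \<^locale>\<open>graph\<close>; an edge is a pair of opposite arcs. In this representation the closed walk
  \<open>a, b, a\<close> is a \<open>cycle\<close>, so the predicate \<open>tree\<close> of \<open>Digraph_Component\<close> fails for every symmetric
  digraph with an arc. The cycles of the undirected graph are the cycles of length at least 3.
\<close>

definition undirected_tree :: "('a, 'b) pre_digraph \<Rightarrow> bool" where
  "undirected_tree T \<longleftrightarrow> graph T \<and> Digraph_Component.connected T \<and>
     \<not> (\<exists>p. pre_digraph.cycle T p \<and> 3 \<le> length p)"

definition graph_dist :: "('a, 'b) pre_digraph \<Rightarrow> 'a \<Rightarrow> 'a \<Rightarrow> nat" where
  "graph_dist G u v = (INF p \<in> {p. pre_digraph.awalk G u p v}. length p)"

text \<open>The description is well defined because \<^const>\<open>graph_dist\<close> is symmetric on a graph.\<close>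

definition wiener_index :: "('a, 'b) pre_digraph \<Rightarrow> nat" where
  "wiener_index G = (\<Sum>P \<in> {P. P \<subseteq> verts G \<and> card P = 2}.
     THE d. \<exists>x y. P = {x, y} \<and> d = graph_dist G x y)"

definition centrality :: "('a, 'b) pre_digraph \<Rightarrow> 'a \<Rightarrow> nat" where
  "centrality G v = (\<Sum>w \<in> verts G. graph_dist G v w)"

definition neighbours :: "('a, 'b) pre_digraph \<Rightarrow> 'a \<Rightarrow> 'a set" where
  "neighbours G x = {y. x \<rightarrow>\<^bsub>G\<^esub> y}"

text \<open>
  A vertex without neighbours (in a connected graph: the vertex of the one-vertex graph) has no
  place to go; there the walk stays put.
\<close>

definition step_targets :: "('a, 'b) pre_digraph \<Rightarrow> 'a \<Rightarrow> 'a set" where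
  "step_targets G x = (if neighbours G x = {} then {x} else neighbours G x)"

text \<open>
  The simple random walk is realised by independent random maps \<open>f\<^sub>0, f\<^sub>1, \<dots>\<close>, each uniformly
  distributed on the maps that send every vertex to one of its neighbours, so that every \<open>f\<^sub>n x\<close>
  is a uniformly random neighbour of \<open>x\<close>: the walk is \<open>X\<^sub>0 = v\<close>, \<open>X\<^bsub>n+1\<^esub> = f\<^sub>n X\<^sub>n\<close>. Its
  finite-dimensional distributions are computed in \<open>prob_simple_random_walk\<close> below.
\<close>

definition step_maps :: "('a, 'b) pre_digraph \<Rightarrow> ('a \<Rightarrow> 'a) set" where
  "step_maps G = (\<Pi>\<^sub>E x \<in> verts G. step_targets G x)"

primcorec trajectory :: "'a \<Rightarrow> ('a \<Rightarrow> 'a) stream \<Rightarrow> 'a stream" where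
  "shd (trajectory v fs) = v"
| "stl (trajectory v fs) = trajectory (shd fs v) (stl fs)"

definition simple_random_walk :: "('a, 'b) pre_digraph \<Rightarrow> 'a \<Rightarrow> 'a stream measure" where
  "simple_random_walk G v =
     distr (stream_space (uniform_count_measure (step_maps G)))
           (stream_space (count_space (verts G))) (trajectory v)"

definition first_visit :: "'a \<Rightarrow> 'a stream \<Rightarrow> enat" where
  "first_visit w \<omega> = (INF n \<in> {n. \<omega> !! n = w}. enat n)"

definition hitting_time :: "('a, 'b) pre_digraph \<Rightarrow> 'a \<Rightarrow> 'a \<Rightarrow> ennreal" where
  "hitting_time G v w = (\<integral>\<^sup>+ \<omega>. ennreal_of_enat (first_visit w \<omega>) \<partial>simple_random_walk G v)"

definition cover_cost :: "('a, 'b) pre_digraph \<Rightarrow> 'a \<Rightarrow> ennreal" where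
  "cover_cost G v = (\<Sum>w \<in> verts G. hitting_time G v w)"


context graph
begin

lemma step_targets_subset: "x \<in> verts G \<Longrightarrow> step_targets G x \<subseteq> verts G"
  by (auto simp: step_targets_def neighbours_def)

lemma step_targets_ne [simp]: "step_targets G x \<noteq> {}"
  by (simp add: step_targets_def)

lemma finite_step_targets: "x \<in> verts G \<Longrightarrow> finite (step_targets G x)"
  using step_targets_subset finite_verts by (rule finite_subset)

lemma finite_step_maps: "finite (step_maps G)"
  unfolding step_maps_def by (intro finite_PiE finite_step_targets finite_verts)

lemma step_maps_ne: "step_maps G \<noteq> {}"
  by (simp add: step_maps_def PiE_eq_empty_iff)

lemma step_mapsD: "f \<in> step_maps G \<Longrightarrow> x \<in> verts G \<Longrightarrow> f x \<in> verts G"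
  using step_targets_subset[of x] by (auto simp: step_maps_def)

abbreviation "steps \<equiv> stream_space (uniform_count_measure (step_maps G))"

lemma prob_space_step_maps: "prob_space (uniform_count_measure (step_maps G))"
  by (intro prob_space_uniform_count_measure finite_step_maps step_maps_ne)

lemma prob_space_steps: "prob_space steps"
  by (rule prob_space.prob_space_stream_space[OF prob_space_step_maps])

lemma trajectory_snth_measurable:
  assumes "v \<in> verts G"
  shows "(\<lambda>fs. trajectory v fs !! n) \<in> measurable steps (count_space (verts G))"
  using assms
proof (induction n arbitrary: v)
  case 0
  then show ?case by simp
next
  case (Suc n)
  have fin: "countable (step_maps G)"
    by (simp add: finite_step_maps countable_finite)
  have sets_eq: "sets (uniform_count_measure (step_maps G)) = sets (count_space (step_maps G))"
    by (simp add: sets_uniform_count_measure)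
  have shd: "shd \<in> measurable steps (count_space (step_maps G))"
    using measurable_shd[of "uniform_count_measure (step_maps G)"]
    by (simp cong: measurable_cong_sets add: measurable_cong_sets[OF refl sets_eq])
  have "(\<lambda>fs. (\<lambda>f fs. trajectory (f v) (stl fs) !! n) (shd fs) fs)
      \<in> measurable steps (count_space (verts G))"
  proof (rule measurable_compose_countable'[OF _ shd fin])
    fix f assume "f \<in> step_maps G"
    then have "f v \<in> verts G"
      using Suc.prems by (rule step_mapsD)
    from Suc.IH[OF this] show "(\<lambda>fs. trajectory (f v) (stl fs) !! n)
        \<in> measurable steps (count_space (verts G))"
      by (rule measurable_compose[OF measurable_stl])
  qed
  then show ?case by simp
qed

lemma trajectory_measurable:
  assumes "v \<in> verts G"
  shows "trajectory v \<in> measurable steps (stream_space (count_space (verts G)))"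
  by (rule measurable_stream_space2) (rule trajectory_snth_measurable[OF assms])

lemma prob_space_simple_random_walk:
  assumes "v \<in> verts G"
  shows "prob_space (simple_random_walk G v)"
  unfolding simple_random_walk_def
  by (rule prob_space.prob_space_distr[OF prob_space_steps trajectory_measurable[OF assms]])

lemma card_step_maps_eval:
  assumes "v \<in> verts G" "y \<in> step_targets G v"
  shows "card {f \<in> step_maps G. f v = y} * card (step_targets G v) = card (step_maps G)"
proof -
  have "{f \<in> step_maps G. f v = y}
      = (\<Pi>\<^sub>E x \<in> verts G. if x = v then {y} else step_targets G x)"
    using assms by (auto simp: step_maps_def PiE_iff extensional_def split: if_splits)
  then have "card {f \<in> step_maps G. f v = y}
      = (\<Prod>x\<in>verts G. card (if x = v then {y} else step_targets G x))"
    by (simp add: card_PiE)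
  also have "\<dots> = (\<Prod>x\<in>verts G - {v}. card (step_targets G x))"
    using assms by (subst prod.remove[of _ v]) (auto intro!: prod.cong)
  finally show ?thesis
    using assms unfolding step_maps_def
    by (simp add: card_PiE prod.remove[of "verts G" v "\<lambda>x. card (step_targets G x)"] mult.commute)
qed

lemma measure_step_maps_eval:
  assumes "v \<in> verts G"
  shows "measure (uniform_count_measure (step_maps G)) {f \<in> step_maps G. f v = y}
    = (if y \<in> step_targets G v then 1 / card (step_targets G v) else 0)"
proof (cases "y \<in> step_targets G v")
  case True
  have "card (step_maps G) > 0"
    using finite_step_maps step_maps_ne by (simp add: card_gt_0_iff)
  moreover define c where "c = card {f \<in> step_maps G. f v = y}"
  ultimately have "real c / card (step_maps G) = 1 / card (step_targets G v)"
    using card_step_maps_eval[OF assms True, folded c_def, symmetric] by simp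
  with True show ?thesis
    by (simp add: measure_uniform_count_measure finite_step_maps c_def)
next
  case False
  then have "{f \<in> step_maps G. f v = y} = {}"
    using assms by (auto simp: step_maps_def)
  with False show ?thesis by (simp only: measure_empty if_False)
qed

definition step_prob :: "'a \<Rightarrow> 'a \<Rightarrow> real" where
  "step_prob x y = (if y \<in> step_targets G x then 1 / card (step_targets G x) else 0)"

lemma prob_trajectory:
  assumes "v \<in> verts G"
  shows "\<P>(fs in steps. \<forall>i\<le>n. trajectory v fs !! i = x i)
    = (if x 0 = v then \<Prod>i<n. step_prob (x i) (x (Suc i)) else 0)"
  using assms
proof (induction n arbitrary: v x)
  case 0
  interpret prob_space steps by (rule prob_space_steps)
  show ?case by (auto simp: prob_space)
next
  case (Suc n)
  let ?U = "uniform_count_measure (step_maps G)"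
  let ?c = "\<Prod>i<n. step_prob (x (Suc i)) (x (Suc (Suc i)))"
  interpret U: prob_space ?U by (rule prob_space_step_maps)
  have c: "0 \<le> ?c"
    by (intro prod_nonneg) (simp add: step_prob_def)
  show ?case
  proof (cases "x 0 = v")
    case False
    then have "{fs \<in> space steps. \<forall>i\<le>Suc n. trajectory v fs !! i = x i} = {}"
      by auto
    with False show ?thesis by (simp only: measure_empty if_False)
  next
    case True
    have [measurable]: "(\<lambda>fs. trajectory v fs !! i) \<in> measurable steps (count_space (verts G))" for i
      by (rule trajectory_snth_measurable[OF Suc.prems])
    have m: "{fs \<in> space steps. \<forall>i\<le>Suc n. trajectory v fs !! i = x i} \<in> sets steps"
      by measurable
    have shift: "(\<forall>i\<le>Suc n. trajectory v (f ## fs) !! i = x i)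
        \<longleftrightarrow> (\<forall>i\<le>n. trajectory (f v) fs !! i = x (Suc i))" for f fs
      using True by (simp add: All_less_Suc2 less_Suc_eq_le[symmetric] del: snth.simps) simp
    have "ennreal (\<P>(fs in steps. \<forall>i\<le>Suc n. trajectory v fs !! i = x i))
        = (\<integral>\<^sup>+f. \<P>(fs in steps. \<forall>i\<le>n. trajectory (f v) fs !! i = x (Suc i)) \<partial>?U)"
      by (subst U.prob_stream_space[OF m]) (simp only: shift)
    also have "\<dots> = (\<integral>\<^sup>+f. ennreal ?c * indicator {f \<in> step_maps G. f v = x (Suc 0)} f \<partial>?U)"
    proof (rule nn_integral_cong)
      fix f assume "f \<in> space ?U"
      then have f: "f \<in> step_maps G" by (simp add: space_uniform_count_measure)
      show "ennreal (\<P>(fs in steps. \<forall>i\<le>n. trajectory (f v) fs !! i = x (Suc i)))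
          = ennreal ?c * indicator {f \<in> step_maps G. f v = x (Suc 0)} f"
        using f Suc.IH[OF step_mapsD[OF f Suc.prems], of "\<lambda>i. x (Suc i)"] by (auto simp: indicator_def)
    qed
    also have "\<dots> = ennreal ?c * emeasure ?U {f \<in> step_maps G. f v = x (Suc 0)}"
      by (rule nn_integral_cmult_indicator) (simp add: sets_uniform_count_measure)
    also have "\<dots> = ennreal (step_prob v (x (Suc 0)) * ?c)"
      using c unfolding U.emeasure_eq_measure measure_step_maps_eval[OF Suc.prems] step_prob_def[symmetric]
      by (simp add: ennreal_mult'' mult.commute)
    finally have "\<P>(fs in steps. \<forall>i\<le>Suc n. trajectory v fs !! i = x i) = step_prob v (x (Suc 0)) * ?c"
      using c by (subst (asm) ennreal_inj) (auto simp: step_prob_def)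
    with True show ?thesis
      by (simp add: prod.lessThan_Suc_shift del: prod.lessThan_Suc)
  qed
qed

theorem prob_simple_random_walk:
  assumes "v \<in> verts G"
  shows "\<P>(\<omega> in simple_random_walk G v. \<forall>i\<le>n. \<omega> !! i = x i)
    = (if x 0 = v then \<Prod>i<n. step_prob (x i) (x (Suc i)) else 0)"
proof -
  let ?S = "stream_space (count_space (verts G))"
  have m: "{\<omega> \<in> space ?S. \<forall>i\<le>n. \<omega> !! i = x i} \<in> sets ?S"
    by measurable
  have "trajectory v -` {\<omega> \<in> space ?S. \<forall>i\<le>n. \<omega> !! i = x i} \<inter> space steps
      = {fs \<in> space steps. \<forall>i\<le>n. trajectory v fs !! i = x i}"
    using measurable_space[OF trajectory_measurable[OF assms]] by auto
  with prob_trajectory[OF assms, of n x] show ?thesis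
    unfolding simple_random_walk_def space_distr
    by (simp only: measure_distr[OF trajectory_measurable[OF assms] m])
qed

end

end

theory Submission
  imports Defs
begin

text \<open>
  Write \<open>d\<close> for the distance and \<open>n\<close> for the number of vertices. In a tree every vertex other than
  \<open>v\<close> has exactly one neighbour that is closer to \<open>v\<close>, and all its other neighbours are farther
  away; this determines the sum of any function of \<open>d(v, x)\<close> over the neighbours \<open>x\<close> of a vertex.
  It follows that \<open>h(v, w) = 1/2 \<Sum>\<^sub>u deg(u) (d(v, w) + d(w, u) - d(v, u))\<close> (Tetali's formula, with
  distances as effective resistances) solves the one-step equations of the hitting times. It is
  their only solution: it dominates the truncated hitting times, so the hitting times are finite,
  and the difference vanishes by the maximum principle. Double counting \<open>d\<close> and \<open>d\<^sup>2\<close> along the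
  arcs gives \<open>\<Sum>\<^sub>u deg(u) = 2(n - 1)\<close> and \<open>\<Sum>\<^sub>u deg(u) d(v, u) = 2 D(v) - (n - 1)\<close>; inserting both
  into \<open>\<Sum>\<^sub>w h(v, w)\<close> yields \<open>2 W(T) - D(v)\<close>.
\<close>

section \<open>Distances\<close>

context graph
begin

lemma adj_sym: "x \<rightarrow> y \<Longrightarrow> y \<rightarrow> x"
  by (rule arcs_ends_symmetric[OF sym_arcs])

lemma neighbours_subset: "neighbours G x \<subseteq> verts G"
  by (auto simp: neighbours_def)

lemma finite_neighbours [simp]: "finite (neighbours G x)"
  using neighbours_subset finite_verts by (rule finite_subset)

abbreviation deg :: "'a \<Rightarrow> real" where
  "deg x \<equiv> real (card (neighbours G x))"

text \<open>Double counting of arcs: by symmetry of adjacency, \<open>x\<close> occurs once for each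
  of its neighbours.\<close>

lemma sum_sum_neighbours:
  fixes g :: "'a \<Rightarrow> real"
  shows "(\<Sum>y\<in>verts G. \<Sum>x\<in>neighbours G y. g x) = (\<Sum>x\<in>verts G. deg x * g x)"
proof -
  have "(\<Sum>y\<in>verts G. \<Sum>x\<in>neighbours G y. g x)
      = (\<Sum>y\<in>verts G. \<Sum>x\<in>{x \<in> verts G. y \<rightarrow> x}. g x)"
    by (intro sum.cong) (auto simp: neighbours_def)
  also have "\<dots> = (\<Sum>x\<in>verts G. \<Sum>y\<in>{y \<in> verts G. y \<rightarrow> x}. g x)"
    by (rule sum.swap_restrict) auto
  also have "\<dots> = (\<Sum>x\<in>verts G. \<Sum>y\<in>neighbours G x. g x)"
    by (intro sum.cong) (auto simp: neighbours_def dest: adj_sym)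
  finally show ?thesis by simp
qed

text \<open>Turns walk lengths into powers of the adjacency relation, from which the triangle
  inequality and the symmetry of distances follow.\<close>

lemma awalk_iff_relpow:
  assumes "u \<in> verts G"
  shows "(\<exists>p. awalk u p v \<and> length p = n) \<longleftrightarrow> (u, v) \<in> arcs_ends G ^^ n"
  using assms
proof (induction n arbitrary: u)
  case 0
  then show ?case by (auto simp: awalk_Nil_iff)
next
  case (Suc n)
  have "(\<exists>p. awalk u p v \<and> length p = Suc n)
      \<longleftrightarrow> (\<exists>e\<in>arcs G. tail G e = u \<and> (\<exists>p. awalk (head G e) p v \<and> length p = n))"
    (is "?l \<longleftrightarrow> ?r")
  proof
    assume ?r
    then obtain e p where "e \<in> arcs G" "tail G e = u" "awalk (head G e) p v" "length p = n"
      by blast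
    then show ?l
      by (intro exI[of _ "e # p"]) (simp add: awalk_Cons_iff)
  next
    assume ?l
    then obtain e p where "awalk u (e # p) v" "length p = n"
      by (auto simp: length_Suc_conv)
    then show ?r
      by (intro bexI[of _ e]) (auto simp: awalk_Cons_iff)
  qed
  also have "\<dots> \<longleftrightarrow> (\<exists>e\<in>arcs G. tail G e = u \<and> (head G e, v) \<in> arcs_ends G ^^ n)"
    using Suc.IH by auto
  also have "\<dots> \<longleftrightarrow> (u, v) \<in> arcs_ends G ^^ Suc n"
    by (auto simp: relpow_commute[symmetric] relcomp_unfold arcs_ends_conv
        simp del: relpow.simps intro: relpow_Suc_I2 elim!: relpow_Suc_E2)
  finally show ?case .
qed

lemma graph_dist_eq_Least:
  assumes "u \<in> verts G"
  shows "graph_dist G u v = (LEAST n. (u, v) \<in> arcs_ends G ^^ n)"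
proof -
  have "n \<in> length ` {p. awalk u p v} \<longleftrightarrow> (u, v) \<in> arcs_ends G ^^ n" for n
    using awalk_iff_relpow[OF assms, of v n] by auto
  then show ?thesis
    by (simp add: graph_dist_def Inf_nat_def)
qed

lemma graph_dist_le:
  "u \<in> verts G \<Longrightarrow> (u, v) \<in> arcs_ends G ^^ n \<Longrightarrow> graph_dist G u v \<le> n"
  by (simp add: graph_dist_eq_Least Least_le)

lemma graph_dist_self [simp]: "u \<in> verts G \<Longrightarrow> graph_dist G u u = 0"
  using graph_dist_le[of u u 0] by simp

lemma relpow_arcs_ends_sym: "(u, v) \<in> arcs_ends G ^^ n \<longleftrightarrow> (v, u) \<in> arcs_ends G ^^ n"
proof -
  have "(v, u) \<in> arcs_ends G ^^ n" if "(u, v) \<in> arcs_ends G ^^ n" for u v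
    using that
  proof (induction n arbitrary: v)
    case (Suc n)
    then obtain x where "(x, u) \<in> arcs_ends G ^^ n" "v \<rightarrow> x"
      by (auto dest: adj_sym)
    then show ?case
      by (metis relpow_Suc_I2)
  qed simp
  then show ?thesis by blast
qed

lemma graph_dist_sym:
  "u \<in> verts G \<Longrightarrow> v \<in> verts G \<Longrightarrow> graph_dist G u v = graph_dist G v u"
  by (simp add: graph_dist_eq_Least relpow_arcs_ends_sym[of u v])

end

text \<open>Reachability is required in the graph itself, whereas \<open>connected\<close> refers to
  the symmetric closure.\<close>

locale connected_graph = graph +
  assumes reachable_verts: "u \<in> verts G \<Longrightarrow> v \<in> verts G \<Longrightarrow> u \<rightarrow>\<^sup>* v"
begin

abbreviation "dist_G \<equiv> graph_dist G"

lemma relpow_graph_dist: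
  assumes "u \<in> verts G" "v \<in> verts G"
  shows "(u, v) \<in> arcs_ends G ^^ dist_G u v"
proof -
  have "(u, v) \<in> (arcs_ends G)\<^sup>*"
    using reachable_verts[OF assms] by (rule reachable_rtranclI)
  then obtain n where "(u, v) \<in> arcs_ends G ^^ n"
    by (auto dest: rtrancl_imp_relpow)
  then show ?thesis
    unfolding graph_dist_eq_Least[OF assms(1)] by (rule LeastI)
qed

lemma graph_dist_triangle:
  assumes "u \<in> verts G" "v \<in> verts G" "w \<in> verts G"
  shows "dist_G u w \<le> dist_G u v + dist_G v w"
  using assms
  by (intro graph_dist_le) (auto simp: relpow_add intro: relpow_graph_dist)

lemma graph_dist_adj:
  assumes "v \<in> verts G" "x \<rightarrow> y"
  shows "dist_G v y \<le> Suc (dist_G v x)"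
proof -
  have "(v, x) \<in> arcs_ends G ^^ dist_G v x"
    using assms by (intro relpow_graph_dist) auto
  then show ?thesis
    using assms by (intro graph_dist_le) auto
qed

lemma graph_dist_eq_0_iff:
  "u \<in> verts G \<Longrightarrow> v \<in> verts G \<Longrightarrow> dist_G u v = 0 \<longleftrightarrow> u = v"
  using relpow_graph_dist[of u v] by auto

text \<open>\<open>x\<close> is the vertex before \<open>u\<close> on a shortest walk from
  \<open>v\<close>.\<close>

lemma closer_neighbour:
  assumes "v \<in> verts G" "u \<in> verts G" "u \<noteq> v"
  obtains x where "u \<rightarrow> x" "dist_G v u = Suc (dist_G v x)"
proof -
  obtain n where n: "dist_G v u = Suc n"
    using graph_dist_eq_0_iff[of v u] assms not0_implies_Suc by auto
  with relpow_graph_dist[of v u] assms obtain x where x: "(v, x) \<in> arcs_ends G ^^ n" "x \<rightarrow> u"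
    by auto
  have "dist_G v x \<le> n"
    using x assms by (intro graph_dist_le)
  \<comment> \<open>A smaller distance to \<open>x\<close> would give a shorter walk to
    \<open>u\<close> through \<open>x\<close>.\<close>
  moreover have "Suc n \<le> Suc (dist_G v x)"
    using graph_dist_adj[OF assms(1) x(2)] n by simp
  ultimately show ?thesis
    using that[of x] x n adj_sym by simp
qed

end

text \<open>Each unordered pair comes from two ordered pairs, at equal distance by symmetry, and the
  diagonal contributes 0.\<close>

lemma two_wiener_index:
  assumes "graph G"
  shows "2 * wiener_index G = (\<Sum>x\<in>verts G. \<Sum>y\<in>verts G. graph_dist G x y)"
proof -
  interpret graph G by fact
  let ?S = "{z \<in> verts G \<times> verts G. fst z \<noteq> snd z}"
  let ?P = "{P. P \<subseteq> verts G \<and> card P = 2}"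
  let ?d = "\<lambda>z. graph_dist G (fst z) (snd z)"
  have "(\<Sum>x\<in>verts G. \<Sum>y\<in>verts G. graph_dist G x y) = sum ?d (verts G \<times> verts G)"
    by (simp add: sum.cartesian_product case_prod_beta)
  also have "\<dots> = sum ?d ?S"
    by (rule sum.mono_neutral_right) auto
  also have "\<dots> = (\<Sum>P\<in>?P. sum ?d {z \<in> ?S. {fst z, snd z} = P})"
    by (rule sum.group[symmetric]) (auto simp: card_2_iff)
  also have "\<dots> = (\<Sum>P\<in>?P. 2 * (THE d. \<exists>x y. P = {x, y} \<and> d = graph_dist G x y))"
  proof (rule sum.cong[OF refl])
    fix P assume "P \<in> ?P"
    then obtain a b where P: "P = {a, b}" "a \<noteq> b" "a \<in> verts G" "b \<in> verts G"
      by (auto simp: card_2_iff)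
    have "{z \<in> ?S. {fst z, snd z} = P} = {(a, b), (b, a)}"
      using P by (auto simp: doubleton_eq_iff)
    then have "sum ?d {z \<in> ?S. {fst z, snd z} = P} = 2 * graph_dist G a b"
      using P graph_dist_sym[of a b] by simp
    \<comment> \<open>By symmetry both namings of the pair give the same distance, so the
      description is unique.\<close>
    moreover have "(THE d. \<exists>x y. P = {x, y} \<and> d = graph_dist G x y) = graph_dist G a b"
      using P graph_dist_sym[of a b] by (intro the_equality) (auto simp: doubleton_eq_iff)
    ultimately show "sum ?d {z \<in> ?S. {fst z, snd z} = P}
        = 2 * (THE d. \<exists>x y. P = {x, y} \<and> d = graph_dist G x y)" by simp
  qed
  finally show ?thesis
    by (simp add: wiener_index_def sum_distrib_left)
qed

section \<open>Hitting times as solutions of the one-step equations\<close>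

lemma first_visit_eq:
  "first_visit w \<omega> = (if \<exists>n. \<omega> !! n = w then enat (LEAST n. \<omega> !! n = w) else \<infinity>)"
proof (cases "\<exists>n. \<omega> !! n = w")
  case True
  then have "\<omega> !! (LEAST n. \<omega> !! n = w) = w"
    by (rule LeastI_ex)
  then show ?thesis
    using True unfolding first_visit_def
    by (auto intro!: antisym INF_lower2 INF_greatest Least_le)
qed (simp add: first_visit_def top_enat_def)

text \<open>Separates time 0 from the rest; with \<open>trajectory_Stream\<close> this drives the
  one-step recursion.\<close>

lemma first_visit_Stream:
  "first_visit w (x ## \<omega>) = (if x = w then 0 else eSuc (first_visit w \<omega>))"
proof (cases "x = w")
  case True
  then have "(LEAST n. (x ## \<omega>) !! n = w) = 0"
    by (intro Least_eq_0) simp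
  moreover have "\<exists>n. (x ## \<omega>) !! n = w"
    using True by (intro exI[of _ 0]) simp
  ultimately show ?thesis
    using True by (simp add: first_visit_eq zero_enat_def)
next
  case False
  have ex: "(\<exists>n. (x ## \<omega>) !! n = w) \<longleftrightarrow> (\<exists>n. \<omega> !! n = w)"
    using False by (metis not0_implies_Suc snth.simps(1) snth_Stream stream.sel(1))
  show ?thesis
  proof (cases "\<exists>n. \<omega> !! n = w")
    case True
    then obtain n where "(x ## \<omega>) !! n = w"
      using ex by auto
    then have "(LEAST n. (x ## \<omega>) !! n = w) = Suc (LEAST n. (x ## \<omega>) !! Suc n = w)"
      using False by (intro Least_Suc) auto
    then show ?thesis
      using True ex False by (simp add: first_visit_eq eSuc_enat)
  qed (use ex False in \<open>simp add: first_visit_eq\<close>)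
qed

lemma first_visit_measurable [measurable]:
  "first_visit w \<in> measurable (stream_space (count_space V)) (count_space UNIV)"
proof -
  \<comment> \<open>The index set depends on \<open>\<omega>\<close>. Giving the other indices the
    neutral value \<open>\<infinity>\<close> yields a countable infimum of measurable
    functions.\<close>
  have "(INF n\<in>{n. \<omega> !! n = w}. enat n) = (INF n. if \<omega> !! n = w then enat n else \<infinity>)" for \<omega>
  proof (rule antisym)
    show "(INF n. if \<omega> !! n = w then enat n else \<infinity>) \<le> (INF n\<in>{n. \<omega> !! n = w}. enat n)"
      by (rule INF_mono) auto
    show "(INF n\<in>{n. \<omega> !! n = w}. enat n) \<le> (INF n. if \<omega> !! n = w then enat n else \<infinity>)"
      by (rule INF_greatest) (auto intro: INF_lower)
  qed
  then have "first_visit w = (\<lambda>\<omega>. INF n. if \<omega> !! n = w then enat n else \<infinity>)"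
    by (auto simp: first_visit_def)
  moreover have "(\<lambda>\<omega>. INF n. if \<omega> !! n = w then enat n else \<infinity>)
      \<in> measurable (stream_space (count_space V)) (count_space UNIV)"
    by measurable
  ultimately show ?thesis by simp
qed

lemma trajectory_Stream: "trajectory v (f ## fs) = v ## trajectory (f v) fs"
  by (rule stream.expand) simp

text \<open>Truncations exhaust even an infinite value, so monotone convergence carries bounds on
  truncated hitting times over to the hitting times.\<close>

lemma ennreal_of_enat_eq_SUP_min:
  "ennreal_of_enat t = (SUP n. ennreal_of_enat (min t (enat n)))"
proof (cases t)
  case (enat k)
  then show ?thesis
    by (intro antisym SUP_upper2[of k] SUP_least) (auto simp: min_def)
next
  case infinity
  then show ?thesis
    by (simp add: ennreal_SUP_of_nat_eq_top)
qed

lemma eSuc_min: "eSuc (min m n) = min (eSuc m) (eSuc n)"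
  by (simp add: min_def)

section \<open>Truncated hitting times and first-step analysis\<close>

context graph
begin

lemma step_prob_nonneg [simp]: "0 \<le> step_prob x y"
  by (simp add: step_prob_def)

lemma sum_step_prob:
  assumes "x \<in> verts G"
  shows "(\<Sum>y\<in>verts G. step_prob x y * g y)
    = (\<Sum>y\<in>step_targets G x. g y) / card (step_targets G x)"
proof -
  have "(\<Sum>y\<in>verts G. step_prob x y * g y) = (\<Sum>y\<in>step_targets G x. step_prob x y * g y)"
    using step_targets_subset[OF assms]
    by (intro sum.mono_neutral_right) (auto simp: step_prob_def)
  then show ?thesis
    by (simp add: step_prob_def sum_divide_distrib)
qed

lemma sum_step_prob_one: "x \<in> verts G \<Longrightarrow> (\<Sum>y\<in>verts G. step_prob x y) = 1"
  using sum_step_prob[of x "\<lambda>_. 1"] finite_step_targets[of x] by simp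

text \<open>Splits the integrand by the value of \<open>f v\<close>, which is \<open>y\<close> with
  probability \<open>step_prob v y\<close>.\<close>

lemma nn_integral_step_maps:
  fixes g :: "'a \<Rightarrow> ennreal"
  assumes "v \<in> verts G"
  shows "(\<integral>\<^sup>+f. g (f v) \<partial>uniform_count_measure (step_maps G))
    = (\<Sum>y\<in>verts G. ennreal (step_prob v y) * g y)"
proof -
  let ?U = "uniform_count_measure (step_maps G)"
  interpret U: prob_space ?U by (rule prob_space_step_maps)
  have "(\<integral>\<^sup>+f. g (f v) \<partial>?U)
      = (\<integral>\<^sup>+f. (\<Sum>y\<in>verts G. g y * indicator {f \<in> step_maps G. f v = y} f) \<partial>?U)"
  proof (rule nn_integral_cong)
    fix f assume "f \<in> space ?U"
    then have f: "f \<in> step_maps G" by (simp add: space_uniform_count_measure)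
    have "(\<Sum>y\<in>verts G. g y * indicator {f \<in> step_maps G. f v = y} f)
        = (\<Sum>y\<in>verts G. if y = f v then g y else 0)"
      using f by (intro sum.cong) (auto simp: indicator_def)
    then show "g (f v) = (\<Sum>y\<in>verts G. g y * indicator {f \<in> step_maps G. f v = y} f)"
      using step_mapsD[OF f assms] by simp
  qed
  also have "\<dots> = (\<Sum>y\<in>verts G. g y * emeasure ?U {f \<in> step_maps G. f v = y})"
    by (subst nn_integral_sum)
      (auto simp: sets_uniform_count_measure nn_integral_cmult_indicator)
  also have "\<dots> = (\<Sum>y\<in>verts G. ennreal (step_prob v y) * g y)"
    unfolding U.emeasure_eq_measure measure_step_maps_eval[OF assms] step_prob_def[symmetric]
    by (simp add: mult.commute)
  finally show ?thesis .
qed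

text \<open>The bound is an \<open>enat\<close> so that \<open>\<infinity>\<close> gives the hitting
  time itself and one recursion serves both cases. Integrating over \<open>steps\<close> lets the
  first map be split off.\<close>

definition truncated_hitting_time :: "enat \<Rightarrow> 'a \<Rightarrow> 'a \<Rightarrow> ennreal" where
  "truncated_hitting_time N v w
    = (\<integral>\<^sup>+fs. ennreal_of_enat (min (first_visit w (trajectory v fs)) N) \<partial>steps)"

lemma first_visit_trajectory_measurable:
  assumes "v \<in> verts G"
  shows "(\<lambda>fs. first_visit w (trajectory v fs)) \<in> measurable steps (count_space UNIV)"
  by (rule measurable_compose[OF trajectory_measurable[OF assms] first_visit_measurable])

lemma truncated_hitting_time_infinity:
  assumes "v \<in> verts G"
  shows "truncated_hitting_time \<infinity> v w = hitting_time G v w"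
proof -
  have "(\<lambda>\<omega>. ennreal_of_enat (first_visit w \<omega>))
      \<in> borel_measurable (stream_space (count_space (verts G)))"
    by measurable
  then show ?thesis
    unfolding truncated_hitting_time_def hitting_time_def simple_random_walk_def
    by (subst nn_integral_distr[OF trajectory_measurable[OF assms]]) auto
qed

lemma truncated_hitting_time_0: "truncated_hitting_time 0 v w = 0"
  by (simp add: truncated_hitting_time_def)

lemma truncated_hitting_time_SUP:
  assumes "v \<in> verts G"
  shows "truncated_hitting_time \<infinity> v w = (SUP n. truncated_hitting_time (enat n) v w)"
proof -
  note [measurable] = first_visit_trajectory_measurable[OF assms]
  have "truncated_hitting_time \<infinity> v w
      = (\<integral>\<^sup>+fs. (SUP n. ennreal_of_enat (min (first_visit w (trajectory v fs)) (enat n))) \<partial>steps)"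
    unfolding truncated_hitting_time_def by (simp add: ennreal_of_enat_eq_SUP_min[symmetric])
  also have "\<dots> = (SUP n. truncated_hitting_time (enat n) v w)"
    unfolding truncated_hitting_time_def
    by (intro nn_integral_monotone_convergence_SUP)
      (auto simp: incseq_def le_fun_def min.coboundedI2)
  finally show ?thesis .
qed

text \<open>First-step analysis: the first map leads from \<open>v\<close> to \<open>f v\<close>,
  and the remaining maps are again independent and uniform.\<close>

lemma truncated_hitting_time_eSuc:
  assumes "v \<in> verts G"
  shows "truncated_hitting_time (eSuc N) v w = (if v = w then 0 else
    1 + (\<Sum>y\<in>verts G. ennreal (step_prob v y) * truncated_hitting_time N y w))"
proof -
  let ?U = "uniform_count_measure (step_maps G)"
  interpret U: prob_space ?U by (rule prob_space_step_maps)
  interpret S: prob_space steps by (rule prob_space_steps)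
  note [measurable] = first_visit_trajectory_measurable[OF assms]
  have step: "truncated_hitting_time (eSuc N) v w = (\<integral>\<^sup>+f. (\<integral>\<^sup>+fs. ennreal_of_enat
      (min (if v = w then 0 else eSuc (first_visit w (trajectory (f v) fs))) (eSuc N)) \<partial>steps) \<partial>?U)"
    unfolding truncated_hitting_time_def
    by (subst U.nn_integral_stream_space) (simp_all add: trajectory_Stream first_visit_Stream)
  show ?thesis
  proof (cases "v = w")
    case True
    then show ?thesis using step by simp
  next
    case False
    have "truncated_hitting_time (eSuc N) v w
        = (\<integral>\<^sup>+f. 1 + truncated_hitting_time N (f v) w \<partial>?U)"
      unfolding step
    proof (rule nn_integral_cong)
      fix f assume "f \<in> space ?U"
      then have "f v \<in> verts G"
        using step_mapsD assms by (simp add: space_uniform_count_measure)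
      note [measurable] = first_visit_trajectory_measurable[OF this]
      show "(\<integral>\<^sup>+fs. ennreal_of_enat (min (if v = w then 0
          else eSuc (first_visit w (trajectory (f v) fs))) (eSuc N)) \<partial>steps)
          = 1 + truncated_hitting_time N (f v) w"
        \<comment> \<open>\<open>eSuc_min\<close> pulls the elapsed step out of the minimum: it
          becomes the summand 1, and the bound drops to \<open>N\<close>.\<close>
        using False unfolding truncated_hitting_time_def
        by (simp add: ennreal_of_enat_eSuc nn_integral_add S.emeasure_space_1 flip: eSuc_min)
    qed
    also have "\<dots> = 1 + (\<integral>\<^sup>+f. truncated_hitting_time N (f v) w \<partial>?U)"
      by (subst nn_integral_add)
        (auto simp: U.emeasure_space_1 sets_uniform_count_measure cong: measurable_cong_sets)
    finally show ?thesis
      using False nn_integral_step_maps[OF assms, of "\<lambda>y. truncated_hitting_time N y w"] by simp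
  qed
qed

end

section \<open>Uniqueness for the one-step equations\<close>

context connected_graph
begin

text \<open>Maximum principle: where the maximum is attained off \<open>w\<close>, averaging forces
  it at every neighbour, and stepping closer each time carries it to \<open>w\<close>.\<close>

lemma harmonic_off_vertex_le:
  fixes e :: "'a \<Rightarrow> real"
  assumes w: "w \<in> verts G"
    and harmonic: "\<And>v. v \<in> verts G \<Longrightarrow> v \<noteq> w \<Longrightarrow> e v = (\<Sum>y\<in>verts G. step_prob v y * e y)"
    and v: "v \<in> verts G"
  shows "e v \<le> e w"
proof -
  define M where "M = Max (e ` verts G)"
  have le: "e y \<le> M" if "y \<in> verts G" for y
    using that by (simp add: M_def)
  have attained: "e w = M" if "x \<in> verts G" "e x = M" for x
    using that
  proof (induction "dist_G w x" arbitrary: x rule: less_induct)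
    case less
    show ?case
    proof (cases "x = w")
      case False
      obtain y where y: "x \<rightarrow> y" "dist_G w x = Suc (dist_G w y)"
        using closer_neighbour[OF w less.prems(1) False] .
      have yV: "y \<in> verts G" using y by auto
      \<comment> \<open>The deficits \<open>M - e y\<close> are nonnegative with mean 0, so each one
        of positive weight vanishes.\<close>
      have "(\<Sum>y\<in>verts G. step_prob x y * (M - e y)) = 0"
        using harmonic[OF less.prems(1) False] less.prems
        by (simp add: right_diff_distrib sum_subtractf sum_distrib_right[symmetric] sum_step_prob_one)
      then have "step_prob x y * (M - e y) = 0"
        using yV le by (subst (asm) sum_nonneg_eq_0_iff) auto
      moreover have "step_prob x y \<noteq> 0"
        using y(1) finite_step_targets[OF less.prems(1)]
        by (auto simp: step_prob_def step_targets_def neighbours_def)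
      ultimately show ?thesis
        using less.hyps[of y] y yV by simp
    qed (use less in simp)
  qed
  have "M \<in> e ` verts G"
    unfolding M_def using w by (intro Max_in) auto
  with attained have "e w = M" by auto
  with le[OF v] show ?thesis by simp
qed

theorem hitting_time_eqI:
  fixes h :: "'a \<Rightarrow> real"
  assumes w: "w \<in> verts G"
    and nonneg: "\<And>v. v \<in> verts G \<Longrightarrow> 0 \<le> h v"
    and target: "h w = 0"
    and step: "\<And>v. v \<in> verts G \<Longrightarrow> v \<noteq> w \<Longrightarrow> h v = 1 + (\<Sum>y\<in>verts G. step_prob v y * h y)"
    and v: "v \<in> verts G"
  shows "hitting_time G v w = ennreal (h v)"
proof -
  let ?H = "\<lambda>N x. truncated_hitting_time N x w"
  \<comment> \<open>The truncations start at 0 and iterate a monotone one-step map that has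
    \<open>h\<close> as a fixed point.\<close>
  have bound: "?H (enat n) x \<le> ennreal (h x)" if "x \<in> verts G" for n x
    using that
  proof (induction n arbitrary: x)
    case 0
    then show ?case
      by (simp add: truncated_hitting_time_0 flip: zero_enat_def)
  next
    case (Suc n)
    show ?case
    proof (cases "x = w")
      case False
      have "?H (enat (Suc n)) x
          = 1 + (\<Sum>y\<in>verts G. ennreal (step_prob x y) * ?H (enat n) y)"
        using False truncated_hitting_time_eSuc[OF Suc.prems, of "enat n" w] by (simp add: eSuc_enat)
      also have "\<dots> \<le> 1 + (\<Sum>y\<in>verts G. ennreal (step_prob x y) * ennreal (h y))"
        by (intro add_left_mono sum_mono mult_left_mono Suc.IH) auto
      also have "\<dots> = 1 + ennreal (\<Sum>y\<in>verts G. step_prob x y * h y)"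
        using nonneg by (simp add: sum_ennreal flip: ennreal_mult)
      also have "\<dots> = ennreal (h x)"
        unfolding step[OF Suc.prems False]
        using nonneg by (subst ennreal_plus) (auto intro!: sum_nonneg)
      finally show ?thesis .
    qed (use truncated_hitting_time_eSuc[OF Suc.prems, of "enat n" w] in \<open>simp add: eSuc_enat\<close>)
  qed
  have le: "?H \<infinity> x \<le> ennreal (h x)" if "x \<in> verts G" for x
    unfolding truncated_hitting_time_SUP[OF that] using bound[OF that] by (intro SUP_least) auto
  define g where "g x = enn2real (?H \<infinity> x)" for x
  \<comment> \<open>\<open>enn2real\<close> sends \<open>\<infinity>\<close> to 0, so this identity
    rests on the finiteness given by \<open>le\<close>.\<close>
  have g: "?H \<infinity> x = ennreal (g x)" if "x \<in> verts G" for x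
    using le[OF that] unfolding g_def
    by (simp add: ennreal_enn2real_if) (metis ennreal_neq_top top.extremum_uniqueI)
  have g_nonneg: "0 \<le> g x" for x
    by (simp add: g_def)
  have g_le: "g x \<le> h x" if "x \<in> verts G" for x
    using le[OF that] nonneg[OF that] by (simp add: g[OF that])
  have g_target: "g w = 0"
    using truncated_hitting_time_eSuc[OF w, of \<infinity> w] by (simp add: g_def)
  have g_step: "g x = 1 + (\<Sum>y\<in>verts G. step_prob x y * g y)" if "x \<in> verts G" "x \<noteq> w" for x
  proof -
    have "ennreal (g x) = 1 + (\<Sum>y\<in>verts G. ennreal (step_prob x y) * ennreal (g y))"
      using truncated_hitting_time_eSuc[OF that(1), of \<infinity> w] that by (simp add: g)
    also have "\<dots> = 1 + ennreal (\<Sum>y\<in>verts G. step_prob x y * g y)"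
      using g_nonneg by (simp add: sum_ennreal flip: ennreal_mult)
    also have "\<dots> = ennreal (1 + (\<Sum>y\<in>verts G. step_prob x y * g y))"
      using g_nonneg by (subst ennreal_plus) (auto intro!: sum_nonneg)
    finally show ?thesis
      using g_nonneg by (subst (asm) ennreal_inj) (auto intro!: add_nonneg_nonneg sum_nonneg)
  qed
  \<comment> \<open>The constant 1 cancels in \<open>h - g\<close>, which is thus harmonic off
    \<open>w\<close>. It vanishes at \<open>w\<close>, so \<open>h v \<le> g v\<close>, the converse
    of \<open>g_le\<close>.\<close>
  have "h v - g v \<le> h w - g w"
    using w _ v
  proof (rule harmonic_off_vertex_le)
    fix x assume "x \<in> verts G" "x \<noteq> w"
    then show "h x - g x = (\<Sum>y\<in>verts G. step_prob x y * (h y - g y))"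
      using step[of x] g_step[of x] by (simp add: right_diff_distrib sum_subtractf)
  qed
  then have "g v = h v"
    using g_le[OF v] target g_target by simp
  then show ?thesis
    using g[OF v] truncated_hitting_time_infinity[OF v] by simp
qed

end

section \<open>Trees\<close>

locale tree_graph = connected_graph +
  assumes no_long_cycle: "cycle p \<Longrightarrow> length p < 3"
begin

text \<open>Two such neighbours \<open>a\<close>, \<open>b\<close> would be joined through \<open>v\<close> by a path that avoids \<open>y\<close>,
  which closes up to a cycle through \<open>y\<close>.\<close>

lemma unique_neighbour_not_farther:
  assumes v: "v \<in> verts G" and "y \<noteq> v"
    and a: "y \<rightarrow> a" "dist_G v a \<le> dist_G v y"
    and b: "y \<rightarrow> b" "dist_G v b \<le> dist_G v y"
  shows "a = b"
proof (rule ccontr)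
  assume "a \<noteq> b"
  \<comment> \<open>Adjacency in the graph with \<open>y\<close> deleted.\<close>
  define R where "R = {(p, q). p \<rightarrow> q \<and> p \<noteq> y \<and> q \<noteq> y}"
  \<comment> \<open>A shortest path from \<open>v\<close> to \<open>x\<close> avoids
    \<open>y\<close>: every vertex before \<open>x\<close> is strictly closer to \<open>v\<close>
    than \<open>y\<close> is.\<close>
  have "(v, x) \<in> R\<^sup>*" if "x \<in> verts G" "x \<noteq> y" "dist_G v x \<le> dist_G v y" for x
    using that
  proof (induction "dist_G v x" arbitrary: x rule: less_induct)
    case less
    show ?case
    proof (cases "x = v")
      case False
      obtain z where z: "x \<rightarrow> z" "dist_G v x = Suc (dist_G v z)"
        using closer_neighbour[OF v less.prems(1) False] .
      then have "z \<noteq> y" "z \<in> verts G"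
        using less.prems by auto
      then have "(v, z) \<in> R\<^sup>*"
        using z less.hyps less.prems by simp
      moreover have "(z, x) \<in> R"
        using adj_sym[OF z(1)] \<open>z \<noteq> y\<close> less.prems by (simp add: R_def)
      ultimately show ?thesis by simp
    qed simp
  qed
  moreover have ab: "a \<in> verts G" "b \<in> verts G" "a \<noteq> y" "b \<noteq> y"
    using a b adj_not_same by auto
  moreover have "sym R"
    by (auto simp: R_def sym_def dest: adj_sym)
  ultimately have "(a, b) \<in> R\<^sup>*"
    using a(2) b(2) by (meson rtrancl_trans sym_rtrancl symD)
  then have "\<exists>p. awalk a p b \<and> y \<notin> head G ` set p"
  proof (induction rule: converse_rtrancl_induct)
    case base
    then show ?case
      using ab by (intro exI[of _ "[]"]) (simp add: awalk_Nil_iff)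
  next
    case (step c z)
    then obtain p e where "awalk z p b" "y \<notin> head G ` set p" "e \<in> arcs G"
        "tail G e = c" "head G e = z" "z \<noteq> y"
      by (auto simp: R_def arcs_ends_conv)
    then show ?case
      by (intro exI[of _ "e # p"]) (auto simp: awalk_Cons_iff)
  qed
  then obtain p where p: "awalk a p b" "y \<notin> head G ` set p" by blast
  \<comment> \<open>Removing repeated vertices keeps only arcs of \<open>p\<close>, so
    \<open>y\<close> is still avoided.\<close>
  define q where "q = awalk_to_apath p"
  have q: "apath a q b" "y \<notin> head G ` set q"
    using p apath_awalk_to_apath[OF p(1)] awalk_to_apath_subset[OF p(1)] by (auto simp: q_def)
  then have walk: "awalk a q b" "distinct (awalk_verts a q)"
    by (auto simp: apath_def)
  \<comment> \<open>The vertices of \<open>q\<close> are its start \<open>a\<close> and the heads of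
    its arcs.\<close>
  have y: "y \<notin> set (awalk_verts a q)"
    using walk q ab by (subst awalk_verts_conv'[of a q b]) (auto simp: awalk_def cas_simp)
  obtain e1 where e1: "e1 \<in> arcs G" "tail G e1 = y" "head G e1 = a"
    using a by (auto simp: arcs_ends_conv)
  obtain e2 where e2: "e2 \<in> arcs G" "tail G e2 = b" "head G e2 = y"
    using adj_sym[OF b(1)] by (auto simp: arcs_ends_conv)
  have e2_walk: "awalk b [e2] y"
    using e2 by (auto simp: awalk_simps)
  then have walk2: "awalk a (q @ [e2]) y"
    using walk by (intro awalk_appendI)
  have "awalk_verts a (q @ [e2]) = awalk_verts a q @ [y]"
    using awalk_verts_append[OF walk2] walk e2 by simp
  \<comment> \<open>The cycle runs from \<open>y\<close> to \<open>a\<close>, along \<open>q\<close>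
    to \<open>b\<close>, and back to \<open>y\<close>. As \<open>a \<noteq> b\<close>,
    \<open>q\<close> is nonempty and the length is at least 3.\<close>
  then have "cycle (e1 # q @ [e2])"
    unfolding cycle_def using e1 e2 walk2 walk y
    by (intro exI[of _ y]) (auto simp: awalk_Cons_iff)
  moreover have "q \<noteq> []"
    using walk \<open>a \<noteq> b\<close> by (auto simp: awalk_Nil_iff)
  ultimately show False
    using no_long_cycle[of "e1 # q @ [e2]"] by (cases q) auto
qed

section \<open>Distance sums over the neighbours of a vertex\<close>

lemma sum_neighbours_dist:
  fixes f :: "nat \<Rightarrow> real"
  assumes v: "v \<in> verts G" and y: "y \<in> verts G" "y \<noteq> v"
  shows "(\<Sum>x\<in>neighbours G y. f (dist_G v x))
    = (deg y - 1) * f (dist_G v y + 1) + f (dist_G v y - 1)"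
proof -
  obtain a where a: "y \<rightarrow> a" "dist_G v y = Suc (dist_G v a)"
    using closer_neighbour[OF v y] .
  have aN: "a \<in> neighbours G y"
    using a by (simp add: neighbours_def)
  have far: "dist_G v x = dist_G v y + 1" if "x \<in> neighbours G y - {a}" for x
  proof -
    have "y \<rightarrow> x" "x \<noteq> a"
      using that by (auto simp: neighbours_def)
    \<comment> \<open>Only \<open>a\<close> is no farther from \<open>v\<close> than
      \<open>y\<close>, and adjacency limits the increase to 1.\<close>
    then have "\<not> dist_G v x \<le> dist_G v y"
      using unique_neighbour_not_farther[OF v y(2) a(1)] a by auto
    then show ?thesis
      using graph_dist_adj[OF v \<open>y \<rightarrow> x\<close>] by simp
  qed
  have "(\<Sum>x\<in>neighbours G y. f (dist_G v x))
      = f (dist_G v a) + (\<Sum>x\<in>neighbours G y - {a}. f (dist_G v x))"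
    by (rule sum.remove) (use aN in auto)
  also have "(\<Sum>x\<in>neighbours G y - {a}. f (dist_G v x))
      = (\<Sum>x\<in>neighbours G y - {a}. f (dist_G v y + 1))"
    using far by (intro sum.cong) auto
  also have "\<dots> = (deg y - 1) * f (dist_G v y + 1)"
  proof -
    have "1 \<le> card (neighbours G y)"
      using aN by (auto simp: Suc_le_eq card_gt_0_iff)
    then show ?thesis
      using aN by (simp add: of_nat_diff)
  qed
  \<comment> \<open>By the choice of \<open>a\<close>, the natural-number difference
    \<open>dist_G v y - 1\<close> is exactly the distance of \<open>a\<close>.\<close>
  finally show ?thesis
    using a by simp
qed

lemma sum_neighbours_dist_self:
  fixes f :: "nat \<Rightarrow> real"
  assumes v: "v \<in> verts G"
  shows "(\<Sum>x\<in>neighbours G v. f (dist_G v x)) = deg v * f 1"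
proof -
  have "dist_G v x = 1" if "v \<rightarrow> x" for x
  proof -
    have "x \<in> verts G" "x \<noteq> v"
      using that adj_not_same by auto
    then show ?thesis
      using graph_dist_adj[OF v that] graph_dist_eq_0_iff[OF v, of x] v by auto
  qed
  then show ?thesis
    by (simp add: neighbours_def)
qed

text \<open>Away from \<open>v\<close>, \<open>deg y - 1\<close> steps outward and one inward change
  the total by \<open>deg y - 2\<close>. At \<open>v\<close> every step goes outward, whence the
  correction 2.\<close>

lemma sum_neighbours_dist1:
  assumes v: "v \<in> verts G" and y: "y \<in> verts G"
  shows "(\<Sum>x\<in>neighbours G y. real (dist_G v x))
    = deg y * real (dist_G v y) + deg y - 2 + (if y = v then 2 else 0)"
proof (cases "y = v")
  case False
  then have "1 \<le> dist_G v y"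
    using graph_dist_eq_0_iff[OF v y] by auto
  then show ?thesis
    using sum_neighbours_dist[OF v y False, of real] False by (simp add: algebra_simps of_nat_diff)
qed (use sum_neighbours_dist_self[OF v, of real] v in simp)

text \<open>The single inward step replaces \<open>(d + 1)\<^sup>2\<close> by
  \<open>(d - 1)\<^sup>2\<close>, a loss of \<open>4 * d\<close>. This is 0 at \<open>v\<close>, so
  both cases share one formula.\<close>

lemma sum_neighbours_dist2:
  assumes v: "v \<in> verts G" and y: "y \<in> verts G"
  shows "(\<Sum>x\<in>neighbours G y. (real (dist_G v x))\<^sup>2)
    = deg y * (real (dist_G v y) + 1)\<^sup>2 - 4 * real (dist_G v y)"
proof (cases "y = v")
  case False
  then have "1 \<le> dist_G v y"
    using graph_dist_eq_0_iff[OF v y] by auto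
  then show ?thesis
    using sum_neighbours_dist[OF v y False, of "\<lambda>n. (real n)\<^sup>2"] False
    by (simp add: algebra_simps of_nat_diff power2_eq_square)
qed (use sum_neighbours_dist_self[OF v, of "\<lambda>n. (real n)\<^sup>2"] v in simp)

section \<open>Degree sums by double counting\<close>

lemma sum_deg:
  assumes v: "v \<in> verts G"
  shows "(\<Sum>x\<in>verts G. deg x) = 2 * (real (card (verts G)) - 1)"
proof -
  have "(\<Sum>x\<in>verts G. deg x * real (dist_G v x))
      = (\<Sum>y\<in>verts G. deg y * real (dist_G v y) + deg y - 2 + (if y = v then 2 else 0))"
    unfolding sum_sum_neighbours[symmetric] using v by (intro sum.cong sum_neighbours_dist1) auto
  also have "\<dots> = (\<Sum>y\<in>verts G. deg y * real (dist_G v y)) + (\<Sum>y\<in>verts G. deg y)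
      - 2 * real (card (verts G)) + 2"
    using v by (simp add: sum.distrib sum_subtractf)
  \<comment> \<open>The degree-weighted distance sum stands on both sides and cancels, leaving the
    sum of the degrees.\<close>
  finally show ?thesis by simp
qed

text \<open>Double counting of the squared distances; the quadratic terms cancel.\<close>

lemma sum_deg_dist:
  assumes v: "v \<in> verts G"
  shows "(\<Sum>x\<in>verts G. deg x * real (dist_G v x))
    = 2 * (\<Sum>x\<in>verts G. real (dist_G v x)) - (real (card (verts G)) - 1)"
proof -
  have "(\<Sum>x\<in>verts G. deg x * (real (dist_G v x))\<^sup>2)
      = (\<Sum>y\<in>verts G. deg y * (real (dist_G v y) + 1)\<^sup>2 - 4 * real (dist_G v y))"
    unfolding sum_sum_neighbours[symmetric] using v by (intro sum.cong sum_neighbours_dist2) auto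
  also have "\<dots> = (\<Sum>y\<in>verts G. deg y * (real (dist_G v y))\<^sup>2
      + 2 * (deg y * real (dist_G v y)) + deg y - 4 * real (dist_G v y))"
    by (intro sum.cong) (auto simp: power2_eq_square algebra_simps)
  also have "\<dots> = (\<Sum>y\<in>verts G. deg y * (real (dist_G v y))\<^sup>2)
      + 2 * (\<Sum>y\<in>verts G. deg y * real (dist_G v y)) + (\<Sum>y\<in>verts G. deg y)
      - 4 * (\<Sum>y\<in>verts G. real (dist_G v y))"
    by (simp add: sum.distrib sum_subtractf sum_distrib_left)
  finally show ?thesis
    using sum_deg[OF v] by simp
qed

section \<open>Hitting times of a tree\<close>

definition tree_hitting_time :: "'a \<Rightarrow> 'a \<Rightarrow> real" where
  "tree_hitting_time v w = (\<Sum>u\<in>verts G.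
     deg u * (real (dist_G v w) + real (dist_G w u) - real (dist_G v u))) / 2"

text \<open>In the sum over the neighbours of \<open>v\<close>, the terms \<open>deg v - 2\<close>
  of the distances to \<open>w\<close> and to \<open>u\<close> cancel. Only \<open>u = v\<close>
  leaves a correction, \<open>-2 * deg v\<close>, which after division by \<open>2 * deg v\<close>
  is the elapsed step.\<close>

lemma tree_hitting_time_step:
  assumes v: "v \<in> verts G" and w: "w \<in> verts G" and "v \<noteq> w"
  shows "tree_hitting_time v w = 1 + (\<Sum>y\<in>verts G. step_prob v y * tree_hitting_time y w)"
proof -
  \<comment> \<open>\<open>v\<close> has a neighbour, so the walk does not stay put and
    \<open>deg v\<close> is a proper divisor.\<close>
  obtain a where "v \<rightarrow> a"
    using closer_neighbour[OF w v \<open>v \<noteq> w\<close>] .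
  then have ne: "neighbours G v \<noteq> {}"
    by (auto simp: neighbours_def)
  have avg: "(\<Sum>x\<in>neighbours G v. real (dist_G x u))
      = deg v * real (dist_G v u) + deg v - 2 + (if u = v then 2 else 0)"
    if "u \<in> verts G" for u
  proof -
    have "(\<Sum>x\<in>neighbours G v. real (dist_G x u)) = (\<Sum>x\<in>neighbours G v. real (dist_G u x))"
      using neighbours_subset[of v] that by (intro sum.cong) (auto intro: graph_dist_sym)
    then show ?thesis
      using sum_neighbours_dist1[OF that v] graph_dist_sym[OF that v] by auto
  qed
  have "2 * (\<Sum>x\<in>neighbours G v. tree_hitting_time x w)
      = (\<Sum>u\<in>verts G. \<Sum>x\<in>neighbours G v.
          deg u * (real (dist_G x w) + real (dist_G w u) - real (dist_G x u)))"
    unfolding tree_hitting_time_def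
    by (subst sum.swap) (simp add: sum_divide_distrib[symmetric])
  also have "\<dots> = (\<Sum>u\<in>verts G. deg u * ((\<Sum>x\<in>neighbours G v. real (dist_G x w))
      + deg v * real (dist_G w u) - (\<Sum>x\<in>neighbours G v. real (dist_G x u))))"
    by (simp add: sum.distrib sum_subtractf flip: sum_distrib_left)
  also have "\<dots> = (\<Sum>u\<in>verts G. deg v * (deg u *
      (real (dist_G v w) + real (dist_G w u) - real (dist_G v u)))
      - (if u = v then 2 * deg v else 0))"
    using \<open>v \<noteq> w\<close> w by (intro sum.cong) (auto simp: avg algebra_simps)
  also have "\<dots> = 2 * deg v * tree_hitting_time v w - 2 * deg v"
    using v by (simp add: sum_subtractf tree_hitting_time_def flip: sum_distrib_left)
  finally have "(\<Sum>x\<in>neighbours G v. tree_hitting_time x w) = deg v * (tree_hitting_time v w - 1)"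
    by (simp add: algebra_simps)
  then have "(\<Sum>x\<in>neighbours G v. tree_hitting_time x w) / deg v = tree_hitting_time v w - 1"
    using ne by simp
  then show ?thesis
    using ne by (simp add: sum_step_prob[OF v] step_targets_def)
qed

lemma tree_hitting_time_nonneg:
  assumes "v \<in> verts G" "w \<in> verts G"
  shows "0 \<le> tree_hitting_time v w"
  unfolding tree_hitting_time_def
proof (intro divide_nonneg_nonneg sum_nonneg mult_nonneg_nonneg)
  fix u assume "u \<in> verts G"
  then show "0 \<le> real (dist_G v w) + real (dist_G w u) - real (dist_G v u)"
    using graph_dist_triangle[of v w u] assms by linarith
qed auto

lemma hitting_time_tree:
  assumes "v \<in> verts G" "w \<in> verts G"
  shows "hitting_time G v w = ennreal (tree_hitting_time v w)"
  using assms(2) _ _ _ assms(1)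
proof (rule hitting_time_eqI)
  show "tree_hitting_time w w = 0"
    using assms by (simp add: tree_hitting_time_def)
qed (use assms tree_hitting_time_nonneg tree_hitting_time_step in auto)

section \<open>Cover cost and Wiener index\<close>

theorem cover_cost_add_centrality:
  assumes v: "v \<in> verts G"
  shows "cover_cost G v + of_nat (centrality G v) = of_nat (2 * wiener_index G)"
proof -
  define n where "n = real (card (verts G))"
  define D where "D x = (\<Sum>w\<in>verts G. real (dist_G x w))" for x
  have deg_D: "(\<Sum>u\<in>verts G. deg u * real (dist_G x u)) = 2 * D x - (n - 1)" if "x \<in> verts G" for x
    using sum_deg_dist[OF that] by (simp add: n_def D_def)
  have wiener: "real (2 * wiener_index G) = (\<Sum>x\<in>verts G. D x)"
    unfolding two_wiener_index[OF graph_axioms] by (simp add: D_def)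
  have "2 * (\<Sum>w\<in>verts G. tree_hitting_time v w)
      = (\<Sum>w\<in>verts G. real (dist_G v w) * (\<Sum>u\<in>verts G. deg u)
        + (\<Sum>u\<in>verts G. deg u * real (dist_G w u)) - (\<Sum>u\<in>verts G. deg u * real (dist_G v u)))"
    unfolding tree_hitting_time_def sum_divide_distrib[symmetric]
    by (simp add: distrib_left right_diff_distrib sum.distrib sum_subtractf sum_distrib_left
        mult.commute)
  \<comment> \<open>The terms \<open>n - 1\<close> coming from \<open>w\<close> and from
    \<open>v\<close> cancel.\<close>
  also have "\<dots> = (\<Sum>w\<in>verts G. real (dist_G v w) * (2 * (n - 1)) + 2 * D w - 2 * D v)"
    using v by (intro sum.cong) (auto simp: deg_D sum_deg[OF v] n_def)
  also have "\<dots> = D v * (2 * (n - 1)) + 2 * (\<Sum>w\<in>verts G. D w) - n * (2 * D v)"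
    by (simp add: sum.distrib sum_subtractf n_def D_def sum_distrib_left sum_distrib_right)
  \<comment> \<open>The coefficients \<open>2 * (n - 1)\<close> and \<open>-2 * n\<close> of
    \<open>D v\<close> combine to \<open>-2\<close>.\<close>
  finally have total: "(\<Sum>w\<in>verts G. tree_hitting_time v w) + D v = real (2 * wiener_index G)"
    unfolding wiener by (simp add: algebra_simps)
  \<comment> \<open>The subtractions were carried out in the reals; nonnegativity of the summands
    transfers the result to \<open>ennreal\<close>.\<close>
  have "cover_cost G v = ennreal (\<Sum>w\<in>verts G. tree_hitting_time v w)"
    using v by (simp add: cover_cost_def hitting_time_tree tree_hitting_time_nonneg sum_ennreal)
  moreover have "of_nat (centrality G v) = ennreal (D v)"
    by (simp add: centrality_def D_def ennreal_of_nat_eq_real_of_nat flip: of_nat_sum)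
  moreover have "0 \<le> D v" "0 \<le> (\<Sum>w\<in>verts G. tree_hitting_time v w)"
    using v by (auto simp: D_def intro!: sum_nonneg tree_hitting_time_nonneg)
  ultimately have "cover_cost G v + of_nat (centrality G v)
      = ennreal ((\<Sum>w\<in>verts G. tree_hitting_time v w) + D v)"
    by simp
  also have "\<dots> = of_nat (2 * wiener_index G)"
    unfolding total by (simp only: ennreal_of_nat_eq_real_of_nat)
  finally show ?thesis .
qed

end

lemma undirected_tree_imp_tree_graph:
  assumes "undirected_tree T"
  shows "tree_graph T"
proof -
  interpret graph T
    using assms by (simp add: undirected_tree_def)
  \<comment> \<open>The symmetric closure adds no adjacency to a symmetric digraph, so reachability
    is the same in both.\<close>
  have "arcs_ends (with_proj (mk_symmetric T)) = arcs_ends T"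
    using adj_sym by (auto simp: parcs_mk_symmetric arcs_ends_conv)
  then have "u \<rightarrow>\<^sup>*\<^bsub>T\<^esub> v" if "u \<in> verts T" "v \<in> verts T" for u v
    using assms that by (auto simp: undirected_tree_def connected_def strongly_connected_def reachable_def)
  then show ?thesis
    using assms by unfold_locales (auto simp: undirected_tree_def not_le[symmetric])
qed

theorem theorem1:
  fixes T :: "('a, 'b) pre_digraph" and v :: 'a
  assumes "undirected_tree T" and "v \<in> verts T"
  shows "(\<Sum>w \<in> verts T. hitting_time T v w + of_nat (graph_dist T v w)) = of_nat (2 * wiener_index T)
    \<and> cover_cost T v + of_nat (centrality T v) = of_nat (2 * wiener_index T)"
proof -
  interpret tree_graph T
    using assms(1) by (rule undirected_tree_imp_tree_graph)
  show ?thesis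
    using cover_cost_add_centrality[OF assms(2)]
    by (simp add: sum.distrib cover_cost_def centrality_def)
qed

end
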